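(* Let $S$ be a countable state space with $\sigma$-algebra $2^S$, let $\mu$ be an initial distribution and $P$ a transition kernel on $S$, and let $(A_1,B_1),\dots,(A_k,B_k)$ with $A_i,B_i\subseteq S$ be a Streett acceptance condition. Suppose there exist: - $I\subseteq S$; - $V_0:S\to\mathbb R_{\ge0}$; - $J_i\subseteq I\setminus A_i$; - $V_i,W_i:S\to\mathbb R_{\ge0}$; - $U_i:S\to\mathbb N$ for $i=1,\dots,k$; such that, for every $i=1,\dots,k$: 1. $\forall s\notin A_i$: $PV_i(s)\le V_i(s)$; 2. $\forall s\in A_i$: $V_i(s)\ge1$; 3. $\exists\gamma_i>0\ \forall s\in J_i$: $V_i(s)\le1-\gamma_i$; 4. $\forall s\in I\setminus(B_i\cup J_i)$: $PW_i(s)\le W_i(s)$; 5. $\forall s\in I\setminus(B_i\cup J_i)$: $W_i(s)>0$; 6. $\forall s\in I\cap(B_i\cup J_i)$: $W_i(s)=U_i(s)=0$; 7. $\forall r\in\mathbb R_{\ge0}\ \exists\varepsilon_r>0\ \forall s\in I\setminus(B_i\cup J_i)$: if $W_i(s)\le r$ then $P(s,\{s':U_i(s')<U_i(s)\})\ge\varepsilon_r$; 8. $\forall r\in\mathbb R_{\ge0}$: the set $U_i[\{s\in I:W_i(s)\le r\}]\subseteq\mathbb N$ is bounded; and moreover: 9. $\forall s\in I$: $PV_0(s)\le V_0(s)$; 10. $\forall s\notin I$: $V_0(s)\ge1$. Then $$\mathsf P_\mu\Big(\bigcap_{i=1}^k\mathrm{Fin}(A_i)\cup\mathrm{Inf}(B_i)\Big)\ge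 1-\mu V_0.$$
   Context: Setting. - $\mathsf P_\mu$ is the law on $S^\omega$ of the time-homogeneous Markov chain $(\Phi_n)$ with initial distribution $\mu$ and kernel $P$. - $\mathrm{Fin}(A)=\bigcup_{n}\bigcap_{m\ge n}\{\Phi_m\notin A\}$ and $\mathrm{Inf}(A)=\bigcap_n\bigcup_{m\ge n}\{\Phi_m\in A\}$. Notation. - For $V:S\to\mathbb R_{\ge0}$: $PV(s)=\sum_{u}V(u)P(s,\{u\})$ (the post-expectation) and $\mu V=\sum_s V(s)\mu(\{s\})$ (the init-expectation). - $U_i[X]$ denotes the image of the set $X$ under $U_i$. *)

theory Defs
  imports "HOL-Probability.Probability"
begin

text \<open>
  The state space is a type of class \<open>countable\<close> carrying the full power set as \<open>\<sigma>\<close>-algebra, so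
  probability measures on it are exactly the values of type \<open>'s pmf\<close>, and Markov kernels on it are
  exactly the functions \<open>'s \<Rightarrow> 's pmf\<close>.  Runs are functions \<open>\<omega> :: nat \<Rightarrow> 's\<close> with
  \<open>\<Phi>\<^sub>n \<omega> = \<omega> n\<close>.
\<close>

abbreviation run_space :: "(nat \<Rightarrow> 's) measure" where
  "run_space \<equiv> \<Pi>\<^sub>M n\<in>(UNIV :: nat set). count_space UNIV"

text \<open>The conditional distribution of \<open>\<Phi>\<^sub>n\<close> given \<open>\<Phi>\<^sub>0, \<dots>, \<Phi>\<^sub>n\<^sub>-\<^sub>1\<close>.\<close>

definition chain_step :: "'s pmf \<Rightarrow> ('s \<Rightarrow> 's pmf) \<Rightarrow> nat \<Rightarrow> (nat \<Rightarrow> 's) \<Rightarrow> 's measure" where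
  "chain_step \<mu> P n \<omega> = (case n of 0 \<Rightarrow> measure_pmf \<mu> | Suc m \<Rightarrow> measure_pmf (P (\<omega> m)))"

text \<open>
  The path measure is the Ionescu-Tulcea limit of the finite-dimensional distributions. Outside the
  locale, its construction is written with the exported constants; \<open>emeasure_chain_law_cylinder\<close> below
  is the usual characterization by cylinder sets.
\<close>

definition chain_law :: "'s::countable pmf \<Rightarrow> ('s \<Rightarrow> 's pmf) \<Rightarrow> (nat \<Rightarrow> 's) measure" where
  "chain_law \<mu> P =
     projective_family.lim UNIV
       (Ionescu_Tulcea.CI (chain_step \<mu> P) (\<lambda>_. count_space UNIV)) (\<lambda>_. count_space UNIV)"

definition fin_often :: "'s set \<Rightarrow> (nat \<Rightarrow> 's) set" where
  "fin_often A = (\<Union>n. \<Inter>m\<in>{n..}. {\<omega>. \<omega> m \<notin> A})"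

definition inf_often :: "'s set \<Rightarrow> (nat \<Rightarrow> 's) set" where
  "inf_often A = (\<Inter>n. \<Union>m\<in>{n..}. {\<omega>. \<omega> m \<in> A})"

text \<open>
  The expectations take values in \<open>[0, \<infinity>]\<close>, where the sum of nonnegative terms always exists.
  They are meant for nonnegative \<open>V\<close> only, because \<open>ennreal\<close> maps negative reals to 0.
\<close>

definition post_exp :: "('s \<Rightarrow> 's pmf) \<Rightarrow> ('s \<Rightarrow> real) \<Rightarrow> 's \<Rightarrow> ennreal" where
  "post_exp P V s = (\<Sum>\<^sub>\<infinity>u. ennreal (V u) * ennreal (pmf (P s) u))"

definition init_exp :: "'s pmf \<Rightarrow> ('s \<Rightarrow> real) \<Rightarrow> ennreal" where
  "init_exp \<mu> V = (\<Sum>\<^sub>\<infinity>s. ennreal (V s) * ennreal (pmf \<mu> s))"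

lemma nn_integral_count_space_eq_infsum:
  fixes f :: "'s::countable \<Rightarrow> ennreal"
  shows "(\<integral>\<^sup>+ x. f x \<partial>count_space UNIV) = infsum f UNIV"
proof (rule antisym)
  have fin: "(\<integral>\<^sup>+ x. f x * indicator F x \<partial>count_space UNIV) = sum f F" if "finite F" for F
    using that by (simp add: nn_integral_count_space_indicator[symmetric] nn_integral_count_space_finite)
  have sup: "infsum f UNIV = (SUP F\<in>{F. finite F \<and> F \<subseteq> UNIV}. sum f F)"
    by (rule nonneg_infsum_complete) simp
  define F where "F n = {x::'s. to_nat x < n}" for n
  have F: "finite (F n)" for n
    unfolding F_def using finite_vimageI[OF finite_lessThan[of n] inj_to_nat]
    by (simp add: vimage_def lessThan_def)
  have f: "f x = (SUP n. f x * indicator (F n) x)" for x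
  proof (rule antisym)
    have "f x = f x * indicator (F (Suc (to_nat x))) x"
      by (simp add: F_def)
    also have "\<dots> \<le> (SUP n. f x * indicator (F n) x)"
      by (rule SUP_upper) simp
    finally show "f x \<le> (SUP n. f x * indicator (F n) x)" .
    show "(SUP n. f x * indicator (F n) x) \<le> f x"
      by (rule SUP_least) (simp add: indicator_def)
  qed
  have "(\<integral>\<^sup>+ x. f x \<partial>count_space UNIV) = (\<integral>\<^sup>+ x. (SUP n. f x * indicator (F n) x) \<partial>count_space UNIV)"
    using f by simp
  also have "\<dots> = (SUP n. \<integral>\<^sup>+ x. f x * indicator (F n) x \<partial>count_space UNIV)"
    by (rule nn_integral_monotone_convergence_SUP)
       (auto simp: incseq_def le_fun_def F_def indicator_def)
  also have "\<dots> = (SUP n. sum f (F n))"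
    using fin F by simp
  also have "\<dots> \<le> infsum f UNIV"
    unfolding sup using F by (intro SUP_least SUP_upper) auto
  finally show "(\<integral>\<^sup>+ x. f x \<partial>count_space UNIV) \<le> infsum f UNIV" .
  show "infsum f UNIV \<le> (\<integral>\<^sup>+ x. f x \<partial>count_space UNIV)"
    unfolding sup
  proof (rule SUP_least)
    fix G :: "'s set" assume "G \<in> {F. finite F \<and> F \<subseteq> UNIV}"
    then have "sum f G = (\<integral>\<^sup>+ x. f x * indicator G x \<partial>count_space UNIV)"
      using fin by simp
    also have "\<dots> \<le> (\<integral>\<^sup>+ x. f x \<partial>count_space UNIV)"
      by (intro nn_integral_mono) (simp add: indicator_def)
    finally show "sum f G \<le> (\<integral>\<^sup>+ x. f x \<partial>count_space UNIV)" .
  qed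
qed

lemma init_exp_eq_nn_integral:
  fixes \<mu> :: "'s::countable pmf"
  shows "init_exp \<mu> V = (\<integral>\<^sup>+ s. ennreal (V s) \<partial>measure_pmf \<mu>)"
proof -
  have "(\<integral>\<^sup>+ s. ennreal (V s) \<partial>measure_pmf \<mu>)
      = (\<integral>\<^sup>+ s. ennreal (V s) * ennreal (pmf \<mu> s) \<partial>count_space UNIV)"
    by (simp add: nn_integral_measure_pmf mult.commute)
  also have "\<dots> = (\<Sum>\<^sub>\<infinity>s. ennreal (V s) * ennreal (pmf \<mu> s))"
    by (rule nn_integral_count_space_eq_infsum)
  finally show ?thesis by (simp add: init_exp_def)
qed

lemma post_exp_eq_nn_integral:
  fixes P :: "'s::countable \<Rightarrow> 's pmf"
  shows "post_exp P V s = (\<integral>\<^sup>+ u. ennreal (V u) \<partial>measure_pmf (P s))"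
  using init_exp_eq_nn_integral[of "P s" V] by (simp add: init_exp_def post_exp_def)

lemma Ionescu_Tulcea_chain:
  fixes \<mu> :: "'s::countable pmf"
  shows "Ionescu_Tulcea (chain_step \<mu> P) (\<lambda>_. count_space UNIV)"
proof (unfold Ionescu_Tulcea_def, intro conjI allI impI)
  fix i :: nat
  show "chain_step \<mu> P i \<in> measurable (PiM {0..<i} (\<lambda>_. count_space UNIV))
      (subprob_algebra (count_space UNIV))"
  proof (cases i)
    case 0
    then show ?thesis
      by (auto simp: chain_step_def[abs_def] space_subprob_algebra intro!: measurable_const
          measure_pmf.subprob_space_axioms)
  next
    case (Suc m)
    have "(\<lambda>x. measure_pmf (P x)) \<in> measurable (count_space UNIV) (subprob_algebra (count_space UNIV))"
      by (auto simp: space_subprob_algebra intro!: measure_pmf.subprob_space_axioms)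
    moreover have "(\<lambda>\<omega>. \<omega> m) \<in> measurable (PiM {0..<i} (\<lambda>_. count_space UNIV)) (count_space UNIV)"
      using Suc by (intro measurable_component_singleton) auto
    ultimately show ?thesis
      unfolding chain_step_def[abs_def] Suc by (simp add: measurable_compose)
  qed
next
  fix i :: nat and x :: "nat \<Rightarrow> 's"
  show "prob_space (chain_step \<mu> P i x)"
    by (cases i) (auto simp: chain_step_def measure_pmf.prob_space_axioms)
qed

lemma sets_chain_law: "sets (chain_law \<mu> P) = sets run_space"
proof -
  interpret Ionescu_Tulcea "chain_step \<mu> P" "\<lambda>_. count_space UNIV"
    by (rule Ionescu_Tulcea_chain)
  show ?thesis
    by (simp add: chain_law_def)
qed

lemma prob_space_chain_law: "prob_space (chain_law \<mu> P)"
proof -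
  interpret Ionescu_Tulcea "chain_step \<mu> P" "\<lambda>_. count_space UNIV"
    by (rule Ionescu_Tulcea_chain)
  have "emeasure PF.lim (PF.emb UNIV {} {\<lambda>_. undefined}) = emeasure (CI {}) {\<lambda>_. undefined}"
    by (rule lim) (auto simp: PiM_empty)
  also have "\<dots> = 1"
    using prob_space.emeasure_space_1[OF PF.prob_space_P[of "{}"]]
    by (simp add: CI_def space_PiM)
  finally show ?thesis
    by (intro prob_spaceI) (simp add: chain_law_def prod_emb_def space_PiM restrict_def)
qed

lemma emeasure_chain_law_cylinder:
  fixes \<mu> :: "'s::countable pmf"
  shows "emeasure (chain_law \<mu> P) {\<omega>. \<forall>i\<le>n. \<omega> i = x i}
    = ennreal (pmf \<mu> (x 0) * (\<Prod>i<n. pmf (P (x i)) (x (Suc i))))"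
proof -
  interpret Ionescu_Tulcea "chain_step \<mu> P" "\<lambda>_. count_space UNIV"
    by (rule Ionescu_Tulcea_chain)
  have meas: "{restrict x {0..<n}} \<in> sets (PiM {0..<n} (\<lambda>_. count_space UNIV))" for n
    using sets_PiM_I_finite[of "{0..<n}" "\<lambda>i. {x i}" "\<lambda>_. count_space UNIV"]
    by (simp add: PiE_singleton[of "restrict x {0..<n}" "{0..<n}", symmetric] cong: PiE_cong)
  have C: "emeasure (C 0 (Suc n) (\<lambda>_. undefined)) {restrict x {0..<Suc n}}
     = emeasure (C 0 n (\<lambda>_. undefined)) {restrict x {0..<n}} *
       emeasure (chain_step \<mu> P n x) {x n}" for n
  proof -
    have u: "(\<lambda>_. undefined) \<in> space (PiM {0..<0::nat} (\<lambda>_. count_space UNIV :: 's measure))"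
      by (simp add: space_PiM)
    have sp: "space (C 0 n (\<lambda>_. undefined)) = space (PiM {0..<n} (\<lambda>_. count_space UNIV))"
      using space_C[OF u, of n] by simp
    have "emeasure (C 0 (Suc n) (\<lambda>_. undefined)) {restrict x {0..<Suc n}}
      = (\<integral>\<^sup>+ w. emeasure (eP n w) {restrict x {0..<Suc n}} \<partial>C 0 n (\<lambda>_. undefined))"
      using sp meas[of "Suc n"] measurable_eP[of n] sets_C[OF u, of n]
      by (simp add: emeasure_bind[where N="PiM {0..<Suc n} (\<lambda>_. count_space UNIV)"] space_PiM PiE_eq_empty_iff
          cong: measurable_cong_sets)
    also have "\<dots> = (\<integral>\<^sup>+ w. emeasure (chain_step \<mu> P n x) {x n} * indicator {restrict x {0..<n}} w
        \<partial>C 0 n (\<lambda>_. undefined))"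
    proof (rule nn_integral_cong)
      fix w assume "w \<in> space (C 0 n (\<lambda>_. undefined))"
      then have w: "w \<in> space (PiM {0..<n} (\<lambda>_. count_space UNIV))" using sp by simp
      have iff: "w(n := y) = restrict x {0..<Suc n} \<longleftrightarrow> w = restrict x {0..<n} \<and> y = x n" for y
        using w by (auto simp: fun_eq_iff space_PiM PiE_iff extensional_def)
      have "fun_upd w n -` {restrict x {0..<Suc n}} = (if w = restrict x {0..<n} then {x n} else {})"
        using iff by auto
      moreover have "chain_step \<mu> P n (restrict x {0..<n}) = chain_step \<mu> P n x"
        by (cases n) (auto simp: chain_step_def)
      ultimately show "emeasure (eP n w) {restrict x {0..<Suc n}}
          = emeasure (chain_step \<mu> P n x) {x n} * indicator {restrict x {0..<n}} w"
        using emeasure_eP[OF w meas[of "Suc n"]] by (auto simp: indicator_def)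
    qed
    also have "\<dots> = emeasure (C 0 n (\<lambda>_. undefined)) {restrict x {0..<n}} *
       emeasure (chain_step \<mu> P n x) {x n}"
      using meas[of n] sets_C[OF u, of n] by (subst nn_integral_cmult_indicator) (simp_all add: mult.commute)
    finally show ?thesis .
  qed
  have "emeasure (C 0 (Suc n) (\<lambda>_. undefined)) {restrict x {0..<Suc n}}
     = ennreal (pmf \<mu> (x 0) * (\<Prod>i<n. pmf (P (x i)) (x (Suc i))))" for n
  proof (induction n)
    case 0
    have "emeasure (C 0 0 (\<lambda>_. undefined)) {restrict x {0..<0}} = 1"
      by (simp add: restrict_def PiM_empty)
    moreover have "emeasure (chain_step \<mu> P 0 x) {x 0} = ennreal (pmf \<mu> (x 0))"
      by (simp add: chain_step_def emeasure_pmf_single)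
    ultimately show ?case
      using C[of 0] by (simp add: restrict_def del: C.simps)
  next
    case (Suc n)
    have "emeasure (chain_step \<mu> P (Suc n) x) {x (Suc n)} = ennreal (pmf (P (x n)) (x (Suc n)))"
      by (simp add: chain_step_def emeasure_pmf_single)
    then show ?case
      using C[of "Suc n"] Suc by (simp add: ennreal_mult'[symmetric] prod_nonneg mult.assoc restrict_def del: C.simps)
  qed
  moreover have "emeasure (chain_law \<mu> P) {\<omega>. \<forall>i\<le>n. \<omega> i = x i}
      = emeasure (C 0 (Suc n) (\<lambda>_. undefined)) {restrict x {0..<Suc n}}"
  proof -
    have "{\<omega>. \<forall>i\<le>n. \<omega> i = x i} = PF.emb UNIV {0..<Suc n} {restrict x {0..<Suc n}}"
      by (auto simp: prod_emb_def space_PiM fun_eq_iff restrict_def less_Suc_eq_le) (metis (full_types))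
    moreover have "PF.emb {0..<Suc n} {0..<Suc n} {restrict x {0..<Suc n}} = {restrict x {0..<Suc n}}"
      by (auto simp: prod_emb_def space_PiM PiE_iff extensional_restrict)
    ultimately show ?thesis
      using lim[OF _ meas[of "Suc n"]] emeasure_CI[OF subset_refl meas[of "Suc n"]]
      by (simp add: chain_law_def del: C.simps)
  qed
  ultimately show ?thesis by simp
qed

end

theory Submission
  imports Defs
begin

text \<open>
  Everything is reduced to one-step arguments on functions \<open>s \<mapsto> \<P>\<^sub>s(E)\<close>. If \<open>g\<close> is superharmonic off
  \<open>T\<close> and dominates \<open>\<P>\<^sub>s(E)\<close> on \<open>T\<close>, where \<open>E\<close> is closed under shifts, then
  \<open>\<P>\<^sub>s(E \<inter> {hit T}) \<le> g s\<close>.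

  With \<open>T\<close> the complement of \<open>I\<close> and \<open>g = V\<^sub>0\<close>, the chain leaves \<open>I\<close> with probability at most
  \<open>\<mu>V\<^sub>0\<close>. For \<open>E = Inf(A\<^sub>i) \<inter> Inf(J\<^sub>i)\<close> and \<open>M = sup \<P>\<^sub>s(E)\<close>, taking \<open>T = A\<^sub>i\<close>, \<open>g = M V\<^sub>i\<close> gives
  \<open>\<P>\<^sub>s(E) \<le> M (1 - \<gamma>\<^sub>i)\<close> on \<open>J\<^sub>i\<close>, and then \<open>T = J\<^sub>i\<close>, \<open>g = M (1 - \<gamma>\<^sub>i)\<close> gives \<open>M \<le> M (1 - \<gamma>\<^sub>i)\<close>, so
  \<open>M = 0\<close>. A chain confined to \<open>D = I - (B\<^sub>i \<union> J\<^sub>i)\<close> exceeds \<open>W\<^sub>i = r\<close> with probability at most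
  \<open>W\<^sub>i(s) / r\<close>, whereas below that level \<open>U\<^sub>i\<close> is bounded by some \<open>N\<close> and decreases with probability
  at least \<open>\<epsilon>\<close>, so that the supremum of the probability to stay is at most \<open>1 - \<epsilon>\<^sup>N\<close> times
  itself. Letting \<open>r \<rightarrow> \<infinity>\<close>, the chain cannot stay in \<open>D\<close> forever. Hence a run that never leaves \<open>I\<close>
  almost surely visits \<open>B\<^sub>i\<close> or \<open>J\<^sub>i\<close> infinitely often, and in the latter case visits \<open>A\<^sub>i\<close> only
  finitely often.
\<close>

section \<open>Cylinder generators and measurability of path events\<close>

text \<open>By countability, an event about coordinate \<open>i\<close> is a countable union of
  cylinders, indexed by lists of length \<open>Suc i\<close>. The empty set joins the generator to
  make it stable under intersection.\<close>

lemma sets_run_space_cylinders: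
  "sets (run_space :: (nat \<Rightarrow> 's::countable) measure) =
     sigma_sets UNIV (insert {} (range (\<lambda>(n, x). {\<omega>. \<forall>i\<le>n. \<omega> i = x i})))"
    (is "_ = sigma_sets UNIV ?G")
proof
  have *: "{f. f i \<in> A} \<in> sigma_sets UNIV ?G" for i and A :: "'s set"
  proof -
    have eq: "{f. f i \<in> A} = (\<Union>l\<in>{l. length l = Suc i \<and> l ! i \<in> A}. {\<omega>. \<forall>j\<le>i. \<omega> j = l ! j})"
      (is "?L = ?R")
    proof
      show "?L \<subseteq> ?R"
      proof
        fix f assume "f \<in> ?L"
        then show "f \<in> ?R"
          by (intro UN_I[of "map f [0..<Suc i]"]) (auto simp del: upt_Suc simp: less_Suc_eq_le)
      qed
    qed auto
    have "?R \<in> sigma_sets UNIV ?G"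
      by (intro sigma_sets_UNION countableI_type) (auto intro!: sigma_sets.Basic)
    then show ?thesis by (simp add: eq)
  qed
  show "sets (run_space :: (nat \<Rightarrow> 's) measure) \<subseteq> sigma_sets UNIV ?G"
    unfolding sets_PiM_single using * by (auto simp: PiE_UNIV_domain intro!: sigma_sets_mono)
next
  have "{\<omega>. \<forall>i\<le>n. \<omega> i = x i} \<in> sets (run_space :: (nat \<Rightarrow> 's) measure)" for n x
  proof -
    have "Measurable.pred run_space (\<lambda>\<omega>::nat \<Rightarrow> 's. \<forall>i\<in>{..n}. \<omega> i = x i)"
      by measurable
    then show ?thesis by (simp add: pred_def space_PiM PiE_UNIV_domain Ball_def)
  qed
  then have "?G \<subseteq> sets (run_space :: (nat \<Rightarrow> 's) measure)" by auto
  then show "sigma_sets UNIV ?G \<subseteq> sets (run_space :: (nat \<Rightarrow> 's) measure)"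
    using sets.sigma_sets_subset[of ?G "run_space :: (nat \<Rightarrow> 's) measure"]
    by (simp add: space_PiM PiE_UNIV_domain)
qed

lemma space_chain_law [simp]: "space (chain_law \<mu> P) = UNIV"
  using sets_eq_imp_space_eq[OF sets_chain_law[of \<mu> P]] by (simp add: space_PiM PiE_UNIV_domain)

declare sets_chain_law [measurable_cong]

lemma measurable_case_nat_run [measurable]: "case_nat s \<in> measurable run_space run_space"
proof (rule measurable_PiM_single')
  fix i :: nat
  show "(\<lambda>\<omega>. case_nat s \<omega> i) \<in> measurable run_space (count_space UNIV)"
    by (cases i) auto
qed (auto simp: space_PiM)

lemma measurable_shift_run [measurable]: "(\<lambda>\<omega> m. \<omega> (m + n)) \<in> measurable run_space run_space"
  by (rule measurable_PiM_single') (auto simp: space_PiM)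

lemma sets_exists: "{\<omega>. \<exists>n\<in>N. \<omega> n \<in> A} \<in> sets run_space"
proof -
  have "{\<omega>. \<omega> n \<in> A} \<in> sets run_space" for n
    using measurable_sets[OF measurable_component_singleton[of n UNIV "\<lambda>_. count_space UNIV"], of A]
    by (simp add: vimage_def space_PiM PiE_UNIV_domain)
  then have "(\<Union>n\<in>N. {\<omega>. \<omega> n \<in> A}) \<in> sets run_space"
    by (intro sets.countable_UN) auto
  also have "(\<Union>n\<in>N. {\<omega>. \<omega> n \<in> A}) = {\<omega>. \<exists>n\<in>N. \<omega> n \<in> A}" by auto
  finally show ?thesis .
qed

lemma sets_run_space_Compl: "E \<in> sets run_space \<Longrightarrow> - E \<in> sets run_space"
  using sets.compl_sets[of E run_space]
  by (simp add: space_PiM PiE_UNIV_domain Compl_eq_Diff_UNIV)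

lemma sets_always: "{\<omega>. \<forall>n. \<omega> n \<in> D} \<in> sets run_space"
  using sets_run_space_Compl[OF sets_exists[of UNIV "- D"]] by (simp add: Compl_eq)

lemma sets_inf_often: "inf_often A \<in> sets run_space"
proof -
  have "inf_often A = (\<Inter>n. {\<omega>. \<exists>m\<in>{n..}. \<omega> m \<in> A})" by (auto simp: inf_often_def)
  also have "\<dots> \<in> sets run_space" using sets_exists by (intro sets.countable_INT) auto
  finally show ?thesis .
qed

section \<open>First-step analysis of the chain\<close>

lemma emeasure_chain_law_finite:
  "emeasure (chain_law \<mu> P) E \<noteq> \<infinity>"
proof -
  interpret prob_space "chain_law \<mu> P" by (rule prob_space_chain_law)
  show ?thesis by simp
qed

lemma measurable_chain_law_case_nat:
  "(\<lambda>s. distr (chain_law (P s) P) run_space (case_nat s))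
     \<in> measurable (measure_pmf \<mu>) (subprob_algebra run_space)"
proof -
  have "case_nat s \<in> measurable (chain_law (P s) P) run_space" for s by measurable
  then have "subprob_space (distr (chain_law (P s) P) run_space (case_nat s))" for s
    by (intro prob_space_imp_subprob_space prob_space.prob_space_distr prob_space_chain_law)
  then show ?thesis by (auto simp: space_subprob_algebra)
qed

text \<open>The Markov property at time one: draw \<open>s\<close> from \<mu>, run the chain from
  \<open>P s\<close>, prepend \<open>s\<close>. Both measures agree on cylinders, which form an
  intersection-stable generator.\<close>

lemma chain_law_eq_bind:
  fixes \<mu> :: "'s::countable pmf"
  shows "chain_law \<mu> P =
    measure_pmf \<mu> \<bind> (\<lambda>s. distr (chain_law (P s) P) run_space (case_nat s))"
    (is "_ = ?R")
proof (rule measure_eqI_generator_eq)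
  let ?G = "insert {} (range (\<lambda>(n, x). {\<omega>::nat \<Rightarrow> 's. \<forall>i\<le>n. \<omega> i = x i}))"
  show "Int_stable ?G"
  proof (rule Int_stableI)
    fix X Y assume XY: "X \<in> ?G" "Y \<in> ?G"
    show "X \<inter> Y \<in> ?G"
    proof (cases "X \<inter> Y = {}")
      case False
      then obtain w where w: "w \<in> X" "w \<in> Y" by blast
      obtain n x where X: "X = {\<omega>. \<forall>i\<le>n. \<omega> i = x i}" using XY(1) w by auto
      obtain m y where Y: "Y = {\<omega>. \<forall>i\<le>m. \<omega> i = y i}" using XY(2) w by auto
      \<comment> \<open>A common run \<open>w\<close> can replace both \<open>x\<close> and
        \<open>y\<close>, so the intersection is the cylinder of \<open>w\<close> of the greater
        length.\<close>
      have "X \<inter> Y = {\<omega>. \<forall>i\<le>max n m. \<omega> i = w i}"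
        using w by (auto simp: X Y le_max_iff_disj)
      then show ?thesis by blast
    qed simp
  qed
  show "?G \<subseteq> Pow UNIV" by simp
  show "sets (chain_law \<mu> P) = sigma_sets UNIV ?G"
    by (simp add: sets_chain_law sets_run_space_cylinders)
  show "sets ?R = sigma_sets UNIV ?G"
    by (subst sets_bind[where N=run_space]) (auto simp: sets_run_space_cylinders)
  show "range (\<lambda>n. {\<omega>::nat \<Rightarrow> 's. \<forall>i\<le>0. \<omega> i = from_nat n}) \<subseteq> ?G"
    by (auto intro!: image_eqI[where x="(0, \<lambda>_. from_nat _)"])
  show "(\<Union>n. {\<omega>::nat \<Rightarrow> 's. \<forall>i\<le>0. \<omega> i = from_nat n}) = UNIV"
    by auto (metis from_nat_to_nat)
  show "emeasure (chain_law \<mu> P) {\<omega>. \<forall>i\<le>0. \<omega> i = from_nat n} \<noteq> \<infinity>" for n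
    by (rule emeasure_chain_law_finite)
  fix X assume X: "X \<in> ?G"
  have X': "X \<in> sets run_space"
    unfolding sets_run_space_cylinders using X by (rule sigma_sets.Basic)
  have R: "emeasure ?R X = (\<integral>\<^sup>+ s. emeasure (chain_law (P s) P) (case_nat s -` X) \<partial>measure_pmf \<mu>)"
    by (subst emeasure_bind[OF _ measurable_chain_law_case_nat X']) (simp_all add: emeasure_distr X')
  show "emeasure (chain_law \<mu> P) X = emeasure ?R X"
  proof (cases "X = {}")
    case False
    then obtain n x where X: "X = {\<omega>. \<forall>i\<le>n. \<omega> i = x i}" using X by auto
    \<comment> \<open>The preimage is empty unless \<open>s = x 0\<close>; then it is a cylinder one
      step shorter, or the whole space for \<open>n = 0\<close>.\<close>
    have "emeasure (chain_law (P s) P) (case_nat s -` X) =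
        ennreal (\<Prod>i<n. pmf (P (x i)) (x (Suc i))) * indicator {x 0} s" for s
    proof (cases "s = x 0")
      case False
      then have "case_nat s -` X = {}" by (force simp: X)
      with False show ?thesis by simp
    next
      case True
      show ?thesis
      proof (cases n)
        case 0
        then have "case_nat s -` X = space (chain_law (P s) P)" using True by (auto simp: X)
        then show ?thesis
          using True 0 prob_space.emeasure_space_1[OF prob_space_chain_law] by simp
      next
        case (Suc m)
        have "case_nat s -` X = {\<omega>. \<forall>i\<le>m. \<omega> i = x (Suc i)}"
          using True Suc by (auto simp: X split: nat.split)
        then show ?thesis
          using True Suc emeasure_chain_law_cylinder[of "P s" P m "\<lambda>i. x (Suc i)"]
          by (simp add: prod.lessThan_Suc_shift del: prod.lessThan_Suc)
      qed
    qed
    then have "emeasure ?R X = ennreal (\<Prod>i<n. pmf (P (x i)) (x (Suc i))) * ennreal (pmf \<mu> (x 0))"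
      unfolding R by (simp add: nn_integral_cmult emeasure_pmf_single)
    also have "\<dots> = ennreal (pmf \<mu> (x 0) * (\<Prod>i<n. pmf (P (x i)) (x (Suc i))))"
      by (simp add: ennreal_mult' mult.commute)
    finally show ?thesis unfolding X by (simp only: emeasure_chain_law_cylinder)
  qed simp
qed

lemma emeasure_chain_law_step:
  fixes \<mu> :: "'s::countable pmf"
  assumes E: "E \<in> sets run_space"
  shows "emeasure (chain_law \<mu> P) E =
    (\<integral>\<^sup>+ s. emeasure (chain_law (P s) P) (case_nat s -` E) \<partial>measure_pmf \<mu>)"
  by (subst chain_law_eq_bind, subst emeasure_bind[OF _ measurable_chain_law_case_nat E])
    (simp_all add: emeasure_distr E)

text \<open>A Dirac initial distribution gives the chain started in \<open>s\<close>, so that every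
  fact about \<open>chain_law\<close> applies.\<close>

definition path_law :: "('s::countable \<Rightarrow> 's pmf) \<Rightarrow> 's \<Rightarrow> (nat \<Rightarrow> 's) measure" where
  "path_law P s = chain_law (return_pmf s) P"

lemma sets_path_law [measurable_cong]: "sets (path_law P s) = sets run_space"
  by (simp add: path_law_def sets_chain_law)

lemma path_law_chain_law:
  assumes "E \<in> sets run_space"
  shows "emeasure (path_law P s) E = emeasure (chain_law (P s) P) (case_nat s -` E)"
  unfolding path_law_def by (subst emeasure_chain_law_step[OF assms]) simp

lemma chain_law_path_law:
  fixes \<mu> :: "'s::countable pmf"
  assumes "E \<in> sets run_space"
  shows "emeasure (chain_law \<mu> P) E = (\<integral>\<^sup>+ s. emeasure (path_law P s) E \<partial>measure_pmf \<mu>)"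
  by (simp only: path_law_chain_law[OF assms] emeasure_chain_law_step[OF assms])

lemma chain_law_null_sets:
  assumes "E \<in> sets run_space" and "\<And>s. emeasure (path_law P s) E = 0"
  shows "E \<in> null_sets (chain_law \<mu> P)"
  using assms by (intro null_setsI) (simp_all add: chain_law_path_law sets_chain_law)

lemma vimage_case_nat_sets:
  assumes "E \<in> sets run_space"
  shows "case_nat s -` E \<in> sets run_space"
  using measurable_sets[OF measurable_case_nat_run assms] by (simp add: space_PiM PiE_UNIV_domain)

text \<open>The basis of all one-step arguments: after the move to \<open>u\<close> the chain
  restarts there, and \<open>E\<close> is tested on the run with \<open>s\<close> put back in
  front.\<close>

lemma path_law_step:
  assumes "E \<in> sets run_space"
  shows "emeasure (path_law P s) E =
    (\<integral>\<^sup>+ u. emeasure (path_law P u) (case_nat s -` E) \<partial>measure_pmf (P s))"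
  by (simp only: path_law_chain_law[OF assms] chain_law_path_law[OF vimage_case_nat_sets[OF assms]])

lemma emeasure_path_law_le_1: "emeasure (path_law P s) E \<le> 1"
proof -
  interpret prob_space "path_law P s" unfolding path_law_def by (rule prob_space_chain_law)
  show ?thesis by (rule emeasure_le_1)
qed

lemma path_law_eq_0_start:
  assumes E: "E \<in> sets run_space" and s: "\<And>\<omega>. \<omega> \<in> E \<Longrightarrow> \<omega> 0 \<noteq> s"
  shows "emeasure (path_law P s) E = 0"
proof -
  have "case_nat s -` E = {}" using s by fastforce
  then show ?thesis by (simp add: path_law_chain_law E)
qed

text \<open>Induction on \<open>n\<close>: with a state prepended, the shift by \<open>Suc n\<close>
  becomes the shift by \<open>n\<close>, so each step integrates zero.\<close>

lemma path_law_null_shift: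
  assumes E: "E \<in> sets run_space" and null: "\<And>s. emeasure (path_law P s) E = 0"
  shows "emeasure (path_law P s) {\<omega>. (\<lambda>m. \<omega> (m + n)) \<in> E} = 0"
proof (induction n arbitrary: s)
  case 0
  then show ?case using null by simp
next
  case (Suc n)
  have shift: "{\<omega>. (\<lambda>m. \<omega> (m + n)) \<in> E} \<in> sets run_space" for n
    using measurable_sets[OF measurable_shift_run E] by (simp add: vimage_def space_PiM PiE_UNIV_domain)
  have "case_nat s -` {\<omega>. (\<lambda>m. \<omega> (m + Suc n)) \<in> E} = {\<omega>. (\<lambda>m. \<omega> (m + n)) \<in> E}" by auto
  then show ?case
    using path_law_step[OF shift[of "Suc n"], of P s] Suc by simp
qed

section \<open>Hitting bounds from superharmonic functions\<close>

text \<open>A maximal inequality, by induction on the time horizon and a monotone limit.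
  \<open>off_T\<close> concerns only starting points of runs in \<open>E\<close>, since
  \<open>E\<close> has probability zero from all other states; thus \<open>E\<close> may confine the
  chain to a region where \<open>g\<close> is superharmonic.\<close>

lemma path_law_hit_le:
  assumes E: "E \<in> sets run_space"
    and tail: "\<And>\<omega>. \<omega> \<in> E \<Longrightarrow> (\<lambda>m. \<omega> (Suc m)) \<in> E"
    and on_T: "\<And>s. s \<in> T \<Longrightarrow> emeasure (path_law P s) E \<le> g s"
    and off_T: "\<And>s \<omega>. s \<notin> T \<Longrightarrow> \<omega> \<in> E \<Longrightarrow> \<omega> 0 = s \<Longrightarrow> (\<integral>\<^sup>+ u. g u \<partial>measure_pmf (P s)) \<le> g s"
  shows "emeasure (path_law P s) (E \<inter> {\<omega>. \<exists>n. \<omega> n \<in> T}) \<le> g s"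
proof -
  define F where "F n = E \<inter> {\<omega>. \<exists>m\<le>n. \<omega> m \<in> T}" for n
  have F: "F n \<in> sets run_space" for n
    using E sets_exists[of "{..n}" T] unfolding F_def by (intro sets.Int) (auto simp: Bex_def)
  have le: "emeasure (path_law P s) (F n) \<le> g s" for n s
  proof (induction n arbitrary: s)
    case 0
    show ?case
    proof (cases "s \<in> T")
      case True
      have "emeasure (path_law P s) (F 0) \<le> emeasure (path_law P s) E"
        using E by (intro emeasure_mono) (auto simp: F_def sets_path_law)
      with on_T[OF True] show ?thesis by simp
    next
      case False
      then have "emeasure (path_law P s) (F 0) = 0"
        by (intro path_law_eq_0_start F) (auto simp: F_def)
      then show ?thesis by simp
    qed
  next
    case (Suc n)
    show ?case
    proof (cases "s \<in> T")
      case True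
      have "emeasure (path_law P s) (F (Suc n)) \<le> emeasure (path_law P s) E"
        using E by (intro emeasure_mono) (auto simp: F_def sets_path_law)
      with on_T[OF True] show ?thesis by simp
    next
      case False
      show ?thesis
      proof (cases "\<exists>\<omega>\<in>E. \<omega> 0 = s")
        case True
        \<comment> \<open>Since \<open>s\<close> is not in \<open>T\<close>, the hit comes after the
          first step, so the tail reaches \<open>T\<close> one step earlier; \<open>tail\<close>
          keeps it in \<open>E\<close>.\<close>
        have "case_nat s -` F (Suc n) \<subseteq> F n"
        proof
          fix \<omega> assume \<omega>: "\<omega> \<in> case_nat s -` F (Suc n)"
          then have "\<omega> \<in> E" using tail[of "case_nat s \<omega>"] by (simp add: F_def)
          moreover from \<omega> obtain m where "m \<le> Suc n" "case_nat s \<omega> m \<in> T" by (auto simp: F_def)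
          ultimately show "\<omega> \<in> F n" using False by (cases m) (auto simp: F_def)
        qed
        then have "emeasure (path_law P s) (F (Suc n))
            \<le> (\<integral>\<^sup>+ u. emeasure (path_law P u) (F n) \<partial>measure_pmf (P s))"
          by (subst path_law_step[OF F]) (intro nn_integral_mono emeasure_mono; simp add: sets_path_law F)
        also have "\<dots> \<le> (\<integral>\<^sup>+ u. g u \<partial>measure_pmf (P s))"
          by (intro nn_integral_mono Suc)
        also have "\<dots> \<le> g s" using True off_T[OF False] by blast
        finally show ?thesis .
      next
        case False
        then have "emeasure (path_law P s) (F (Suc n)) = 0"
          by (intro path_law_eq_0_start F) (auto simp: F_def)
        then show ?thesis by simp
      qed
    qed
  qed
  have "E \<inter> {\<omega>. \<exists>n. \<omega> n \<in> T} = (\<Union>n. F n)" by (auto simp: F_def)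
  also have "emeasure (path_law P s) \<dots> = (SUP n. emeasure (path_law P s) (F n))"
  proof (rule SUP_emeasure_incseq[symmetric])
    show "incseq F" by (auto simp: F_def incseq_def) (meson order_trans)
  qed (use F sets_path_law in auto)
  also have "\<dots> \<le> g s" using le by (rule SUP_least)
  finally show ?thesis .
qed

section \<open>Infinitely many visits to both \<open>A\<close> and \<open>J\<close>\<close>

lemma fin_often_eq: "fin_often A = - inf_often A"
  by (auto simp: fin_often_def inf_often_def)

lemma inf_often_shift: "\<omega> \<in> inf_often A \<Longrightarrow> (\<lambda>m. \<omega> (Suc m)) \<in> inf_often A"
  unfolding inf_often_def
proof (intro INT_I)
  fix n
  assume "\<omega> \<in> (\<Inter>n. \<Union>m\<in>{n..}. {\<omega>. \<omega> m \<in> A})"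
  then obtain m where "Suc n \<le> m" "\<omega> m \<in> A" by force
  then show "(\<lambda>m. \<omega> (Suc m)) \<in> (\<Union>m\<in>{n..}. {\<omega>. \<omega> m \<in> A})"
    by (cases m) auto
qed

lemma path_law_inf_often_null:
  fixes V :: "'s::countable \<Rightarrow> real"
  assumes super: "\<And>s. s \<notin> A \<Longrightarrow> post_exp P V s \<le> ennreal (V s)"
    and V_A: "\<And>s. s \<in> A \<Longrightarrow> 1 \<le> V s"
    and \<gamma>: "0 < \<gamma>" and V_J: "\<And>s. s \<in> J \<Longrightarrow> V s \<le> 1 - \<gamma>"
  shows "emeasure (path_law P s) (inf_often A \<inter> inf_often J) = 0"
proof -
  define E where "E = inf_often A \<inter> inf_often J"
  define M where "M = (SUP s. emeasure (path_law P s) E)"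
  have E: "E \<in> sets run_space" unfolding E_def by (intro sets.Int sets_inf_often)
  have tail: "\<omega> \<in> E \<Longrightarrow> (\<lambda>m. \<omega> (Suc m)) \<in> E" for \<omega> by (simp add: E_def inf_often_shift)
  have M: "emeasure (path_law P s) E \<le> M" for s unfolding M_def by (rule SUP_upper) simp
  have M1: "M \<le> 1" unfolding M_def by (intro SUP_least emeasure_path_law_le_1)
  \<comment> \<open>Runs in \<open>E\<close> hit both sets, so the hitting bounds below speak of
    \<open>E\<close> itself.\<close>
  have EA: "E \<inter> {\<omega>. \<exists>n. \<omega> n \<in> A} = E" and EJ: "E \<inter> {\<omega>. \<exists>n. \<omega> n \<in> J} = E"
    by (auto simp: E_def inf_often_def)
  have V: "emeasure (path_law P s) E \<le> M * ennreal (V s)" for s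
  proof -
    have "emeasure (path_law P s) (E \<inter> {\<omega>. \<exists>n. \<omega> n \<in> A}) \<le> M * ennreal (V s)"
    proof (rule path_law_hit_le[OF E tail])
      fix s assume "s \<in> A"
      then have "M * 1 \<le> M * ennreal (V s)" using V_A by (intro mult_left_mono) auto
      then show "emeasure (path_law P s) E \<le> M * ennreal (V s)" using M[of s] by simp
    next
      fix s assume "s \<notin> A"
      then show "(\<integral>\<^sup>+ u. M * ennreal (V u) \<partial>measure_pmf (P s)) \<le> M * ennreal (V s)"
        using super by (auto simp: nn_integral_cmult post_exp_eq_nn_integral intro!: mult_left_mono)
    qed
    then show ?thesis by (simp only: EA)
  qed
  have "emeasure (path_law P s) (E \<inter> {\<omega>. \<exists>n. \<omega> n \<in> J}) \<le> M * ennreal (1 - \<gamma>)" for s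
  proof (rule path_law_hit_le[OF E tail])
    fix s assume "s \<in> J"
    then have "M * ennreal (V s) \<le> M * ennreal (1 - \<gamma>)"
      using V_J by (intro mult_left_mono ennreal_leI) auto
    then show "emeasure (path_law P s) E \<le> M * ennreal (1 - \<gamma>)" using V[of s] by simp
  next
    fix s
    show "(\<integral>\<^sup>+ u. M * ennreal (1 - \<gamma>) \<partial>measure_pmf (P s)) \<le> M * ennreal (1 - \<gamma>)"
      by (subst nn_integral_const) (simp del: nn_integral_const)
  qed
  then have le: "M \<le> M * ennreal (1 - \<gamma>)"
    unfolding EJ by (subst M_def) (rule SUP_least)
  \<comment> \<open>A finite nonzero \<open>M\<close> would shrink strictly under the factor, which
    is below 1 also for \<gamma> > 1, where \<open>ennreal\<close> truncates it to 0.\<close>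
  have "M = 0"
  proof (rule ccontr)
    assume "M \<noteq> 0"
    moreover have "M < \<infinity>" using M1 by (simp add: order_le_less_trans)
    moreover have "ennreal (1 - \<gamma>) < 1" using \<gamma> by (simp add: ennreal_less_one_iff)
    ultimately have "M * ennreal (1 - \<gamma>) < M * 1"
      by (intro ennreal_mult_strict_left_mono) (auto simp: zero_less_iff_neq_zero)
    with le show False by simp
  qed
  then show ?thesis using M[of s] by (simp add: E_def)
qed

section \<open>Progress excludes confinement\<close>

text \<open>Think of \<open>h s\<close> as the probability of staying in \<open>D\<close> forever.
  At most \<open>N\<close> successive decreases of \<open>U\<close>, each of probability at least
  \<epsilon>, force an exit from \<open>D\<close>; hence any uniform bound \<open>c\<close> on
  \<open>h\<close> improves by the factor \<open>1 - \<epsilon> ^ N\<close>.\<close>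

lemma subharmonic_null_if_progress:
  fixes h :: "'s \<Rightarrow> ennreal" and U :: "'s \<Rightarrow> nat"
  assumes h1: "\<And>s. h s \<le> 1"
    and h0: "\<And>s. s \<notin> D \<Longrightarrow> h s = 0"
    and sub: "\<And>s. s \<in> D \<Longrightarrow> h s \<le> (\<integral>\<^sup>+ u. h u \<partial>measure_pmf (P s))"
    and U: "\<And>s. s \<in> D \<Longrightarrow> U s \<le> N"
    and \<epsilon>: "0 < \<epsilon>" "\<epsilon> \<le> 1"
    and prog: "\<And>s. s \<in> D \<Longrightarrow> \<epsilon> \<le> measure_pmf.prob (P s) {s'. U s' < U s}"
  shows "h s = 0"
proof -
  have contract: "h s \<le> ennreal (c * (1 - \<epsilon> ^ N))" if c: "\<And>s. h s \<le> ennreal c" "0 \<le> c" for c s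
  proof -
    have *: "h s \<le> ennreal (c * (1 - \<epsilon> ^ U s))" if "s \<in> D" for s
      using that
    proof (induction "U s" arbitrary: s rule: less_induct)
      case less
      let ?A = "{s'. U s' < U s}"
      \<comment> \<open>Progress is impossible from \<open>U s = 0\<close>, hence no such state lies in \<open>D\<close>.\<close>
      have "?A \<noteq> {}" using prog[OF less(2)] \<epsilon> by (metis measure_empty not_le)
      then obtain n where n: "U s = Suc n" by (cases "U s") auto
      \<comment> \<open>For \<open>u\<close> in \<open>D\<close> and \<open>?A\<close>,
        \<open>U u \<le> n\<close> and the induction hypothesis saves at least
        \<open>c * \<epsilon> ^ n\<close>; off \<open>D\<close>, \<open>h u\<close> is 0, and off
        \<open>?A\<close> the bound \<open>c\<close> is enough.\<close>
      have "h u \<le> ennreal (c - c * \<epsilon> ^ n * indicator ?A u)" for u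
      proof (cases "u \<in> D \<and> U u < U s")
        case True
        then have "\<epsilon> ^ n \<le> \<epsilon> ^ U u" using \<epsilon> n by (intro power_decreasing) auto
        then have "c * (1 - \<epsilon> ^ U u) \<le> c * (1 - \<epsilon> ^ n)" using c by (intro mult_left_mono) auto
        then show ?thesis
          using order_trans[OF less(1)[of u] ennreal_leI] True by (simp add: algebra_simps)
      next
        case False
        then show ?thesis using h0[of u] c(1)[of u] by (auto simp: indicator_def)
      qed
      then have "(\<integral>\<^sup>+ u. h u \<partial>measure_pmf (P s)) \<le>
          (\<integral>\<^sup>+ u. ennreal (c - c * \<epsilon> ^ n * indicator ?A u) \<partial>measure_pmf (P s))"
        by (intro nn_integral_mono)
      also have "\<dots> = ennreal (\<integral>u. c - c * \<epsilon> ^ n * indicator ?A u \<partial>measure_pmf (P s))"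
      proof (rule nn_integral_eq_integral)
        show "integrable (measure_pmf (P s)) (\<lambda>u. c - c * \<epsilon> ^ n * indicator ?A u)"
          by (intro Bochner_Integration.integrable_diff integrable_mult_right
              measure_pmf.integrable_const integrable_real_indicator)
            (auto simp: less_top[symmetric])
        have "c * \<epsilon> ^ n \<le> c * 1" using \<epsilon> c by (intro mult_left_mono power_le_one) auto
        then show "AE u in measure_pmf (P s). 0 \<le> c - c * \<epsilon> ^ n * indicator ?A u"
          using c by (auto simp: indicator_def)
      qed
      also have "(\<integral>u. c - c * \<epsilon> ^ n * indicator ?A u \<partial>measure_pmf (P s)) =
          c - c * \<epsilon> ^ n * measure_pmf.prob (P s) ?A"
        by (subst Bochner_Integration.integral_diff) (auto simp: less_top[symmetric])
      also have "ennreal \<dots> \<le> ennreal (c - c * \<epsilon> ^ n * \<epsilon>)"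
        using prog[OF less(2)] c \<epsilon> by (intro ennreal_leI diff_left_mono mult_left_mono) auto
      also have "c - c * \<epsilon> ^ n * \<epsilon> = c * (1 - \<epsilon> ^ U s)" by (simp add: n algebra_simps)
      finally show ?case using sub[OF less(2)] by (rule order_trans[rotated])
    qed
    show ?thesis
    proof (cases "s \<in> D")
      case True
      have "\<epsilon> ^ N \<le> \<epsilon> ^ U s" using \<epsilon> U[OF True] by (intro power_decreasing) auto
      then have "c * (1 - \<epsilon> ^ U s) \<le> c * (1 - \<epsilon> ^ N)" using c by (intro mult_left_mono) auto
      then show ?thesis using order_trans[OF *[OF True] ennreal_leI] by blast
    qed (simp add: h0)
  qed
  define q where "q = 1 - \<epsilon> ^ N"
  have q: "0 \<le> q" "q < 1" using \<epsilon> by (auto simp: q_def power_le_one)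
  \<comment> \<open>Starting from \<open>h1\<close>, each application of \<open>contract\<close>
    contributes one more factor \<open>q < 1\<close>.\<close>
  have "h s \<le> ennreal (q ^ n)" for n s
  proof (induction n arbitrary: s)
    case 0
    then show ?case using h1 by simp
  next
    case (Suc n)
    then show ?case using contract[of "q ^ n" s] q by (simp add: q_def[symmetric] mult.commute)
  qed
  moreover have "(\<lambda>n. ennreal (q ^ n)) \<longlonglongrightarrow> ennreal 0"
    using q by (intro tendsto_ennrealI LIMSEQ_realpow_zero)
  ultimately have "h s \<le> ennreal 0" by (intro LIMSEQ_le_const) auto
  then show ?thesis by simp
qed

lemma path_law_always_null:
  fixes W :: "'s::countable \<Rightarrow> real" and U :: "'s \<Rightarrow> nat"
  assumes W_nonneg: "\<And>s. 0 \<le> W s"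
    and super: "\<And>s. s \<in> D \<Longrightarrow> post_exp P W s \<le> ennreal (W s)"
    and prog: "\<And>r. 0 \<le> r \<Longrightarrow> \<exists>\<epsilon>>0. \<forall>s\<in>D. W s \<le> r \<longrightarrow> \<epsilon> \<le> measure_pmf.prob (P s) {s'. U s' < U s}"
    and bdd: "\<And>r. 0 \<le> r \<Longrightarrow> bdd_above (U ` {s \<in> D. W s \<le> r})"
  shows "emeasure (path_law P s) {\<omega>. \<forall>n. \<omega> n \<in> D} = 0"
proof -
  define E where "E = {\<omega>::nat \<Rightarrow> 's. \<forall>n. \<omega> n \<in> D}"
  have E: "E \<in> sets run_space" unfolding E_def by (rule sets_always)
  have bound: "emeasure (path_law P s) E \<le> ennreal (W s / r)" if r: "0 < r" for r
  proof -
    \<comment> \<open>Below level \<open>r\<close> the progress probability is bounded away from 0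
      and \<open>U\<close> is bounded above, as the contraction requires.\<close>
    define D' where "D' = {s \<in> D. W s \<le> r}"
    define E' where "E' = {\<omega>::nat \<Rightarrow> 's. \<forall>n. \<omega> n \<in> D'}"
    have E': "E' \<in> sets run_space" unfolding E'_def by (rule sets_always)
    obtain \<epsilon>0 where \<epsilon>0: "\<epsilon>0 > 0" "\<And>s. s \<in> D' \<Longrightarrow> \<epsilon>0 \<le> measure_pmf.prob (P s) {s'. U s' < U s}"
      using prog[of r] r by (auto simp: D'_def)
    obtain N where N: "\<And>s. s \<in> D' \<Longrightarrow> U s \<le> N"
      using bdd[of r] r by (auto simp: D'_def bdd_above_def)
    have null: "emeasure (path_law P s) E' = 0" for s
    \<comment> \<open>The cap at 1 secures \<open>\<epsilon> \<le> 1\<close> even when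
      \<open>D'\<close> is empty and \<open>\<epsilon>0\<close> is thus unconstrained.\<close>
    proof (rule subharmonic_null_if_progress[where D=D' and N=N and \<epsilon>="min \<epsilon>0 1" and P=P and U=U])
      fix s assume "s \<in> D'"
      then have "case_nat s -` E' = E'" 
        by (auto simp: E'_def split: nat.split)
      then show "emeasure (path_law P s) E' \<le> (\<integral>\<^sup>+ u. emeasure (path_law P u) E' \<partial>measure_pmf (P s))"
        by (subst path_law_step[OF E']) simp
    qed (use N \<epsilon>0 in \<open>auto simp: emeasure_path_law_le_1 min.coboundedI1 intro!: path_law_eq_0_start E'\<close>,
        auto simp: E'_def)
    \<comment> \<open>The hitting bound with \<open>g = W / r\<close>: runs in \<open>E\<close>
      start in \<open>D\<close>, where \<open>W\<close> is superharmonic.\<close>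
    have hit: "emeasure (path_law P s) (E \<inter> {\<omega>. \<exists>n. \<omega> n \<in> {s. r < W s}}) \<le> ennreal (W s / r)"
    proof (rule path_law_hit_le[OF E])
      fix s assume "s \<in> {s. r < W s}"
      then have "1 \<le> W s / r" using r by simp
      then show "emeasure (path_law P s) E \<le> ennreal (W s / r)"
        using emeasure_path_law_le_1[of P s E] by (meson ennreal_ge_1 order_trans)
    next
      fix s \<omega> assume "\<omega> \<in> E" "\<omega> 0 = s"
      then have "s \<in> D" by (auto simp: E_def)
      have "ennreal (W u / r) = ennreal (W u) * ennreal (1 / r)" for u
        using r W_nonneg by (simp add: ennreal_mult[symmetric])
      then show "(\<integral>\<^sup>+ u. ennreal (W u / r) \<partial>measure_pmf (P s)) \<le> ennreal (W s / r)"
        using super[OF \<open>s \<in> D\<close>] by (simp add: nn_integral_multc post_exp_eq_nn_integral mult_right_mono)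
    qed (auto simp: E_def)
    have H: "{\<omega>. \<exists>n. \<omega> n \<in> {s. r < W s}} \<in> sets run_space"
      using sets_exists[of UNIV "{s. r < W s}"] by simp
    \<comment> \<open>A run in \<open>E\<close> either keeps \<open>W\<close> at most
      \<open>r\<close> at all times, hence lies in \<open>E'\<close>, or exceeds \<open>r\<close> at
      some time.\<close>
    have "emeasure (path_law P s) E
        \<le> emeasure (path_law P s) (E' \<union> (E \<inter> {\<omega>. \<exists>n. \<omega> n \<in> {s. r < W s}}))"
      using E E' H by (intro emeasure_mono) (auto simp: sets_path_law E_def E'_def D'_def not_less)
    also have "\<dots> \<le> emeasure (path_law P s) E' +
        emeasure (path_law P s) (E \<inter> {\<omega>. \<exists>n. \<omega> n \<in> {s. r < W s}})"
      using E E' H by (intro emeasure_subadditive) (auto simp: sets_path_law)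
    also have "\<dots> \<le> ennreal (W s / r)" using hit null by simp
    finally show ?thesis .
  qed
  have "(\<lambda>n. ennreal (W s / real (Suc n))) \<longlonglongrightarrow> ennreal 0"
    by (intro tendsto_ennrealI lim_const_over_n[THEN LIMSEQ_Suc])
  moreover have "emeasure (path_law P s) E \<le> ennreal (W s / real (Suc n))" for n
    by (rule bound) simp
  ultimately have "emeasure (path_law P s) E \<le> ennreal 0" by (intro LIMSEQ_le_const) blast+
  then show ?thesis by (simp add: E_def)
qed

section \<open>The probability of leaving \<open>I\<close>\<close>

lemma path_law_leave_le:
  fixes V :: "'s::countable \<Rightarrow> real"
  assumes "\<And>s. s \<in> I \<Longrightarrow> post_exp P V s \<le> ennreal (V s)" and "\<And>s. s \<notin> I \<Longrightarrow> 1 \<le> V s"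
  shows "emeasure (path_law P s) {\<omega>. \<exists>n. \<omega> n \<notin> I} \<le> ennreal (V s)"
proof -
  have "emeasure (path_law P s) (UNIV \<inter> {\<omega>. \<exists>n. \<omega> n \<in> - I}) \<le> ennreal (V s)"
  proof (rule path_law_hit_le)
    show "UNIV \<in> sets run_space"
      using sets.top[of run_space] by (simp add: space_PiM PiE_UNIV_domain)
    show "emeasure (path_law P s) UNIV \<le> ennreal (V s)" if "s \<in> - I" for s
      using that assms(2)[of s] emeasure_path_law_le_1[of P s UNIV]
      by (meson ComplD ennreal_ge_1 order_trans)
  qed (use assms(1) in \<open>auto simp: post_exp_eq_nn_integral\<close>)
  then show ?thesis by simp
qed

section \<open>Covering the failure of the Streett condition by exit from \<open>I\<close> and null
  events\<close>

theorem theorem4p4: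
  fixes \<mu> :: "'s::countable pmf" and P :: "'s \<Rightarrow> 's pmf"
    and k :: nat and A B :: "nat \<Rightarrow> 's set"
    and I :: "'s set" and V0 :: "'s \<Rightarrow> real"
    and J :: "nat \<Rightarrow> 's set"
    and V W :: "nat \<Rightarrow> 's \<Rightarrow> real"
    and U :: "nat \<Rightarrow> 's \<Rightarrow> nat"
  assumes V0_nonneg: "\<And>s. V0 s \<ge> 0"
    and J_subset: "\<And>i. i \<in> {1..k} \<Longrightarrow> J i \<subseteq> I - A i"
    and V_nonneg: "\<And>i s. i \<in> {1..k} \<Longrightarrow> V i s \<ge> 0"
    and W_nonneg: "\<And>i s. i \<in> {1..k} \<Longrightarrow> W i s \<ge> 0"
    and c1: "\<And>i. i \<in> {1..k} \<Longrightarrow> \<forall>s. s \<notin> A i \<longrightarrow> post_exp P (V i) s \<le> ennreal (V i s)"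
    and c2: "\<And>i. i \<in> {1..k} \<Longrightarrow> \<forall>s\<in>A i. V i s \<ge> 1"
    and c3: "\<And>i. i \<in> {1..k} \<Longrightarrow> \<exists>\<gamma>>0. \<forall>s\<in>J i. V i s \<le> 1 - \<gamma>"
    and c4: "\<And>i. i \<in> {1..k} \<Longrightarrow>
               \<forall>s\<in>I - (B i \<union> J i). post_exp P (W i) s \<le> ennreal (W i s)"
    and c5: "\<And>i. i \<in> {1..k} \<Longrightarrow> \<forall>s\<in>I - (B i \<union> J i). W i s > 0"
    and c6: "\<And>i. i \<in> {1..k} \<Longrightarrow> \<forall>s\<in>I \<inter> (B i \<union> J i). W i s = 0 \<and> U i s = 0"
    and c7: "\<And>i. i \<in> {1..k} \<Longrightarrow>
               \<forall>r\<ge>0. \<exists>\<epsilon>>0. \<forall>s\<in>I - (B i \<union> J i).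
                 W i s \<le> r \<longrightarrow> measure_pmf.prob (P s) {s'. U i s' < U i s} \<ge> \<epsilon>"
    and c8: "\<And>i. i \<in> {1..k} \<Longrightarrow> \<forall>r\<ge>0. bdd_above (U i ` {s \<in> I. W i s \<le> r})"
    and c9: "\<forall>s\<in>I. post_exp P V0 s \<le> ennreal (V0 s)"
    and c10: "\<forall>s. s \<notin> I \<longrightarrow> V0 s \<ge> 1"
  shows "ereal (measure (chain_law \<mu> P) (\<Inter>i\<in>{1..k}. fin_often (A i) \<union> inf_often (B i)))
           \<ge> 1 - enn2ereal (init_exp \<mu> V0)"
proof -
  interpret L: prob_space "chain_law \<mu> P" by (rule prob_space_chain_law)
  define G where "G = (\<Inter>i\<in>{1..k}. fin_often (A i) \<union> inf_often (B i))"
  define leave where "leave = {\<omega>::nat \<Rightarrow> 's. \<exists>n. \<omega> n \<notin> I}"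
  define D where "D i = I - (B i \<union> J i)" for i
  \<comment> \<open>In \<open>late i n\<close> the run stays in \<open>D i\<close> from time
    \<open>n\<close> on; the shift reduces this to confinement from time 0.\<close>
  define late where "late i n = {\<omega>::nat \<Rightarrow> 's. (\<lambda>m. \<omega> (m + n)) \<in> {\<omega>. \<forall>n. \<omega> n \<in> D i}}" for i n
  define bad where "bad i = (inf_often (A i) \<inter> inf_often (J i)) \<union> (\<Union>n. late i n)" for i
  have leave: "leave \<in> sets run_space"
    using sets_exists[of UNIV "- I"] by (simp add: leave_def)
  have late: "late i n \<in> sets run_space" for i n
    using measurable_sets[OF measurable_shift_run sets_always]
    by (simp add: late_def vimage_def space_PiM PiE_UNIV_domain)
  have bad: "bad i \<in> sets run_space" for i
    unfolding bad_def using late by (intro sets.Un sets.Int sets_inf_often sets.countable_UN) auto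
  have bad_null: "bad i \<in> null_sets (chain_law \<mu> P)" if i: "i \<in> {1..k}" for i
  proof -
    have "emeasure (path_law P s) (inf_often (A i) \<inter> inf_often (J i)) = 0" for s
      using c1[OF i] c2[OF i] c3[OF i]
      by (auto intro!: path_law_inf_often_null[where V="V i"])
    then have 1: "inf_often (A i) \<inter> inf_often (J i) \<in> null_sets (chain_law \<mu> P)"
      by (intro chain_law_null_sets sets.Int sets_inf_often)
    have "emeasure (path_law P s) {\<omega>. \<forall>n. \<omega> n \<in> D i} = 0" for s
    proof (rule path_law_always_null[where W="W i" and U="U i"])
      show "bdd_above (U i ` {s \<in> D i. W i s \<le> r})" if "0 \<le> r" for r
        using c8[OF i] that by (auto simp: D_def intro: bdd_above_mono)
    qed (use W_nonneg[OF i] c4[OF i] c7[OF i] in \<open>auto simp: D_def\<close>)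
    then have "emeasure (path_law P s) (late i n) = 0" for s n
      unfolding late_def by (rule path_law_null_shift[OF sets_always])
    then have "late i n \<in> null_sets (chain_law \<mu> P)" for n
      using late by (intro chain_law_null_sets)
    with 1 show ?thesis unfolding bad_def by auto
  qed
  have G: "G \<in> sets run_space"
  proof -
    have "- G = (\<Union>i\<in>{1..k}. inf_often (A i) \<inter> - inf_often (B i))"
      by (auto simp: G_def fin_often_eq)
    also have "\<dots> \<in> sets run_space"
      by (intro sets.finite_UN sets.Int sets_run_space_Compl sets_inf_often) auto
    finally show ?thesis using sets_run_space_Compl by fastforce
  qed
  have cover: "- G \<subseteq> leave \<union> (\<Union>i\<in>{1..k}. bad i)"
  proof
    fix \<omega> assume "\<omega> \<in> - G"
    then obtain i where i: "i \<in> {1..k}" "\<omega> \<in> inf_often (A i)" "\<omega> \<notin> inf_often (B i)"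
      by (auto simp: G_def fin_often_eq)
    show "\<omega> \<in> leave \<union> (\<Union>i\<in>{1..k}. bad i)"
    proof (cases "\<omega> \<in> leave \<or> \<omega> \<in> inf_often (J i)")
      case True
      then show ?thesis using i by (auto simp: bad_def)
    next
      case False
      \<comment> \<open>\<open>B i\<close> and \<open>J i\<close> are avoided from possibly
        different times on; \<open>n + m\<close> serves for both.\<close>
      then obtain n m where "\<forall>l\<ge>n. \<omega> l \<notin> B i" "\<forall>l\<ge>m. \<omega> l \<notin> J i" "\<forall>l. \<omega> l \<in> I"
        using i by (simp add: inf_often_def leave_def Ball_def) blast
      then have "\<omega> \<in> late i (n + m)" by (auto simp: late_def D_def)
      then show ?thesis using i by (auto simp: bad_def)
    qed
  qed
  have "emeasure (chain_law \<mu> P) (- G) \<le> emeasure (chain_law \<mu> P) (leave \<union> (\<Union>i\<in>{1..k}. bad i))"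
    using cover leave bad by (intro emeasure_mono) (auto simp: sets_chain_law)
  also have "\<dots> = emeasure (chain_law \<mu> P) leave"
    using bad_null leave by (intro emeasure_Un_null_set null_sets_UN') (auto simp: sets_chain_law)
  also have "\<dots> = (\<integral>\<^sup>+ s. emeasure (path_law P s) leave \<partial>measure_pmf \<mu>)"
    by (rule chain_law_path_law[OF leave])
  also have "\<dots> \<le> init_exp \<mu> V0"
    unfolding init_exp_eq_nn_integral leave_def
    using c9 c10 by (intro nn_integral_mono path_law_leave_le) auto
  finally have le: "emeasure (chain_law \<mu> P) (- G) \<le> init_exp \<mu> V0" .
  have "L.prob (- G) = 1 - L.prob G"
    using L.prob_compl[of G] G by (simp add: sets_chain_law Compl_eq_Diff_UNIV)
  then have "1 - ereal (L.prob G) = enn2ereal (emeasure (chain_law \<mu> P) (- G))"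
    by (simp add: L.emeasure_eq_measure enn2ereal_ennreal one_ereal_def)
  also have "\<dots> \<le> enn2ereal (init_exp \<mu> V0)" using le by (simp add: less_eq_ennreal.rep_eq)
  finally have "1 - ereal (L.prob G) \<le> enn2ereal (init_exp \<mu> V0)" .
  \<comment> \<open>If the initial expectation is infinite, the left-hand side is -\<infinity> in
    \<open>ereal\<close>, so the rearrangement holds in that case too.\<close>
  then have "1 - enn2ereal (init_exp \<mu> V0) \<le> ereal (L.prob G)"
    by (cases "enn2ereal (init_exp \<mu> V0)") (auto simp: one_ereal_def)
  then show ?thesis by (simp add: G_def)
qed


end
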